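(* Assume conditions (S1)--(S4) of the context. Then there exists a non-empty family of distributions $\pi^*\in\Delta_{m-1}$, with $\pi^*\in\Delta_{m-1}^\circ$ provided all neutral weights (the weights $\pi^*_{z_0}$ at sites with $\sigma(z_0)=z_0$) are chosen strictly positive, such that $C(\pi^*,\gamma)=C^*$ for all $\gamma\in(0,1)$, where $$C^*=\frac{1}{1+\sqrt{K}}.$$ More precisely: (i) each $\pi^*$ in the family satisfies $$\frac{\pi^*_z}{\pi^*_{\sigma(z)}}=\sqrt{\frac{\kappa(\sigma(z))}{\kappa(z)}}\qquad\text{for all reset sites } z \text{ with } \sigma(z)\neq z;$$ (ii) for each neutral site $z_0$ with $\sigma(z_0)=z_0$, the weight $\pi^*_{z_0}\ge 0$ is completely free, subject only to normalization; (iii) the value $C^*$ depends only on $K$, not on the specific choice of $\pi^*$ within the family nor on the neutral weights.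
   Context: Let $m\ge 2$, let $z_1,\dots,z_m$ be distinct points (the reset sites), $\Delta_{m-1}=\{\pi\in\mathbb{R}^m:\pi_i\ge 0,\ \sum_i\pi_i=1\}$, and $\Delta_{m-1}^\circ$ its relative interior (all $\pi_i>0$). For a site $z=z_i$ write $\pi_z=\pi_i$. The coupling functional is a smooth functional $C:\Delta_{m-1}\times(0,1)\to\mathbb{R}$, $(\pi,\gamma)\mapsto C(\pi,\gamma)$. Conditions: (S1) For each fixed $\gamma\in(0,1)$ the map $\pi\mapsto C(\pi,\gamma)$ is of class $\mathcal{C}^1$ on $\Delta_{m-1}^\circ$ and extends continuously to the boundary. (S2) There are functions $u(z;\gamma), s(z;\gamma)$ with $C(\pi,\gamma)=\dfrac{\sum_{i}\pi_i u(z_i;\gamma)}{\sum_{i}\pi_i s(z_i;\gamma)}$, the denominator being strictly positive for all $\pi\in\Delta_{m-1}$, $\gamma\in(0,1)$. Moreover $u(z;\gamma)=\sum_{\nu=1}^N f_\nu(\gamma)A_\nu(z)$ and $s(z;\gamma)=\sum_{\nu=1}^N f_\nu(\gamma)(A_\nu(z)+B_\nu(z))$ with $N\ge 1$ and real coefficients $A_\nu(z),B_\nu(z)$, where the functions $f_1,\dots,f_N$ are linearly independent on $(0,1)$ and the $m$ vectors $(A_\nu(z_i))_{\nu=1}^N$, $i=1,\dots,m$, are linearly independent in $\mathbb{R}^N$ (so $m\le N$). (S3) There are an involution $\sigma$ of the set of reset sites ($\sigma^2=\mathrm{id}$), with at least one site $z$ such that $\sigma(z)\ne z$, and weights $\kappa(z)>0$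 independent of $\nu$, such that $B_\nu(z)=\kappa(z)A_\nu(\sigma(z))$ for all $\nu$ and all reset sites $z$. (S4) There is a constant $K>0$, the same for all reset sites, such that $\kappa(z)\kappa(\sigma(z))=K$ for all reset sites $z$. A site $z_0$ with $\sigma(z_0)=z_0$ is called neutral (then $\kappa(z_0)=\sqrt K$). *)

theory Defs
  imports "HOL-Analysis.Analysis"
begin

text \<open>
  The reset sites are \<open>z i\<close> for \<open>i :: 'n\<close>, with \<open>z\<close> injective and \<open>m = CARD('n)\<close>; a distribution over
  the sites is a vector \<open>\<pi> :: real ^ 'n\<close>.
\<close>

definition prob_simplex :: "(real ^ 'n) set" where
  "prob_simplex = {\<pi>. (\<forall>i. 0 \<le> \<pi> $ i) \<and> (\<Sum>i\<in>UNIV. \<pi> $ i) = 1}"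

definition open_prob_simplex :: "(real ^ 'n) set" where
  "open_prob_simplex = {\<pi> \<in> prob_simplex. \<forall>i. 0 < \<pi> $ i}"

lemma rel_interior_prob_simplex:
  "rel_interior (prob_simplex :: (real ^ 'n) set) = open_prob_simplex"
proof -
  let ?S = "prob_simplex :: (real ^ 'n) set"
  let ?m = "real CARD('n)"
  let ?c = "(\<chi> i. 1 / ?m) :: real ^ 'n"
  have cS: "?c \<in> ?S"
    by (simp add: prob_simplex_def)
  have "convex ?S"
    unfolding convex_def prob_simplex_def
    by (simp add: sum.distrib flip: sum_distrib_left)
  then have iff: "\<pi> \<in> rel_interior ?S \<longleftrightarrow> (\<forall>x\<in>?S. \<exists>e>1. (1 - e) *\<^sub>R x + e *\<^sub>R \<pi> \<in> ?S)" for \<pi>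
    using cS by (intro convex_rel_interior_iff) auto
  show ?thesis
  proof (intro set_eqI iffI)
    fix \<pi> assume \<pi>: "\<pi> \<in> rel_interior ?S"
    then obtain e where e: "e > 1" "(1 - e) *\<^sub>R ?c + e *\<^sub>R \<pi> \<in> ?S"
      using iff cS by blast
    have "0 < \<pi> $ i" for i
    proof -
      have "0 \<le> (1 - e) * (1 / ?m) + e * \<pi> $ i"
        using e(2) by (simp add: prob_simplex_def)
      moreover have "(1 - e) * (1 / ?m) < 0"
        using e(1) by (intro mult_neg_pos) simp_all
      ultimately have "0 < e * \<pi> $ i"
        by linarith
      then show ?thesis
        using e(1) by (simp add: zero_less_mult_iff)
    qed
    then show "\<pi> \<in> open_prob_simplex"
      using \<pi> rel_interior_subset by (auto simp: open_prob_simplex_def)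
  next
    fix \<pi> :: "real ^ 'n" assume \<pi>: "\<pi> \<in> open_prob_simplex"
    have "\<exists>e>1. (1 - e) *\<^sub>R x + e *\<^sub>R \<pi> \<in> ?S" if x: "x \<in> ?S" for x
    proof -
      define d where "d = Min (range (\<lambda>i. \<pi> $ i))"
      have d: "d > 0" "\<And>i. d \<le> \<pi> $ i"
        using \<pi> by (auto simp: d_def open_prob_simplex_def)
      have x1: "x $ i \<le> 1" for i
        using x member_le_sum[of i UNIV "\<lambda>i. x $ i"] by (simp add: prob_simplex_def)
      have "0 \<le> (1 - (1 + d)) * x $ i + (1 + d) * \<pi> $ i" for i
      proof -
        have "d * x $ i \<le> d"
          using x1[of i] d(1) by (simp add: mult_le_cancel_left1)
        moreover have "0 \<le> d * \<pi> $ i"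
          using d(1) order.trans[OF less_imp_le[OF d(1)] d(2)[of i]] by simp
        ultimately show ?thesis
          using d(2)[of i] by (simp add: algebra_simps)
      qed
      then have "(1 - (1 + d)) *\<^sub>R x + (1 + d) *\<^sub>R \<pi> \<in> ?S"
        using x \<pi> by (simp add: prob_simplex_def open_prob_simplex_def sum.distrib
            sum_subtractf flip: sum_distrib_left)
      then show ?thesis
        using d(1) by (intro exI[of _ "1 + d"]) simp
    qed
    then show "\<pi> \<in> rel_interior ?S"
      using iff by blast
  qed
qed

definition site_weight :: "('n \<Rightarrow> 'p) \<Rightarrow> real ^ 'n \<Rightarrow> 'p \<Rightarrow> real" where
  "site_weight z \<pi> p = \<pi> $ (inv z p)"

lemma site_weight_site: "inj z \<Longrightarrow> site_weight z \<pi> (z i) = \<pi> $ i"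
  by (simp add: site_weight_def)

definition neutral_sites :: "('n \<Rightarrow> 'p) \<Rightarrow> ('p \<Rightarrow> 'p) \<Rightarrow> 'p set" where
  "neutral_sites z \<sigma> = {p \<in> range z. \<sigma> p = p}"

definition nonneutral_sites :: "('n \<Rightarrow> 'p) \<Rightarrow> ('p \<Rightarrow> 'p) \<Rightarrow> 'p set" where
  "nonneutral_sites z \<sigma> = {p \<in> range z. \<sigma> p \<noteq> p}"

text \<open>
  Derivatives are taken within \<open>S\<close>, since the intended \<open>S\<close> is a relatively open subset of an affine
  hyperplane. Only the restriction of \<open>f' x\<close> to the directions of the hyperplane is determined by
  \<open>f\<close>; as \<open>f'\<close> may be composed with the orthogonal projection onto these directions, the existence
  of a continuous choice is the usual continuous differentiability on the hyperplane.
\<close>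

definition C1_on :: "('a::euclidean_space \<Rightarrow> real) \<Rightarrow> 'a set \<Rightarrow> bool" where
  "C1_on f S \<longleftrightarrow> (\<exists>f' :: 'a \<Rightarrow> 'a \<Rightarrow>\<^sub>L real.
     (\<forall>x\<in>S. (f has_derivative blinfun_apply (f' x)) (at x within S)) \<and> continuous_on S f')"

definition lin_indep_functions_on :: "'x set \<Rightarrow> ('k::finite \<Rightarrow> 'x \<Rightarrow> real) \<Rightarrow> bool" where
  "lin_indep_functions_on S f \<longleftrightarrow>
     (\<forall>c. (\<forall>x\<in>S. (\<Sum>\<nu>\<in>UNIV. c \<nu> * f \<nu> x) = 0) \<longrightarrow> (\<forall>\<nu>. c \<nu> = 0))"

text \<open>
  Linear independence of a family: the members are distinct and form an independent set.
\<close>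

definition lin_indep_family :: "('n::finite \<Rightarrow> 'v::real_vector) \<Rightarrow> bool" where
  "lin_indep_family v \<longleftrightarrow> inj v \<and> independent (range v)"

end

theory Submission
  imports Defs
begin

text \<open>
  Each neutral site satisfies \<open>\<kappa> = sqrt K\<close>, so the ratios in (i) amount to the detailed balance
  relation \<open>\<kappa>(p) \<pi>(p) = sqrt K \<pi>(\<sigma>(p))\<close> at every site. Since \<open>s(p) = u(p) + \<kappa>(p) u(\<sigma>(p))\<close>,
  reindexing by \<open>\<sigma>\<close> turns the denominator of the coupling into \<open>1 + sqrt K\<close> times its numerator.
  The relation is homogeneous and does not constrain neutral sites, and \<open>1 / sqrt (\<kappa>(p))\<close> solves it.
\<close>

text \<open>Balance is written without quotients, so that one equation covers neutral sites with
  weight zero as well. Because it is homogeneous, it would allow both weights of a pair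
  \<open>p\<close>, \<open>\<sigma> p\<close> to vanish; the positivity clause rules this out and
  keeps the ratios in (i) meaningful.\<close>

definition balanced_simplex ::
    "('n::finite \<Rightarrow> 'p) \<Rightarrow> ('p \<Rightarrow> 'p) \<Rightarrow> ('p \<Rightarrow> real) \<Rightarrow> real \<Rightarrow> (real ^ 'n) set" where
  "balanced_simplex z \<sigma> \<kappa> K = {\<pi> \<in> prob_simplex.
     (\<forall>p\<in>range z. \<kappa> p * site_weight z \<pi> p = sqrt K * site_weight z \<pi> (\<sigma> p)) \<and>
     (\<forall>p\<in>nonneutral_sites z \<sigma>. 0 < site_weight z \<pi> p)}"

lemma sum_sites_eq:
  fixes z :: "'n::finite \<Rightarrow> 'p" and g :: "'p \<Rightarrow> real"
  assumes "inj z"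
  shows "(\<Sum>i\<in>UNIV. \<pi> $ i * g (z i)) = (\<Sum>p\<in>range z. site_weight z \<pi> p * g p)"
  using assms by (simp add: sum.reindex site_weight_site)

lemma site_weight_vec_lambda:
  assumes "inj z" "p \<in> range z"
  shows "site_weight z (\<chi> i. g (z i)) p = g p"
  using assms by (auto simp: site_weight_site)

lemma vec_lambda_in_prob_simplex:
  fixes z :: "'n::finite \<Rightarrow> 'p"
  assumes "inj z" "\<And>p. p \<in> range z \<Longrightarrow> 0 \<le> g p" "(\<Sum>p\<in>range z. g p) = 1"
  shows "(\<chi> i. g (z i)) \<in> (prob_simplex :: (real ^ 'n) set)"
  using assms by (simp add: prob_simplex_def sum.reindex)

lemma sum_range_split_neutral:
  fixes z :: "'n::finite \<Rightarrow> 'p" and g :: "'p \<Rightarrow> real"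
  shows "(\<Sum>p\<in>range z. g p) = (\<Sum>p\<in>neutral_sites z \<sigma>. g p) + (\<Sum>p\<in>nonneutral_sites z \<sigma>. g p)"
proof -
  have "range z = neutral_sites z \<sigma> \<union> nonneutral_sites z \<sigma>"
    by (auto simp: neutral_sites_def nonneutral_sites_def)
  moreover have "finite (neutral_sites z \<sigma>)" "finite (nonneutral_sites z \<sigma>)"
    by (simp_all add: neutral_sites_def nonneutral_sites_def)
  moreover have "neutral_sites z \<sigma> \<inter> nonneutral_sites z \<sigma> = {}"
    by (auto simp: neutral_sites_def nonneutral_sites_def)
  ultimately show ?thesis
    by (simp add: sum.union_disjoint)
qed

text \<open>Balance moves the weight from \<open>p\<close> to \<open>\<sigma> p\<close>, where
  \<open>v\<close> is already evaluated, and \<open>\<sigma>\<close> permutes \<open>S\<close>; so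
  the second summand contributes \<open>c\<close> times the first. With \<open>v\<close> the
  function \<open>u\<close> at a fixed \<open>\<gamma>\<close> and \<open>c = sqrt K\<close>, this
  compares denominator and numerator of the coupling.\<close>

lemma balanced_weighted_sum:
  fixes wt \<kappa> v :: "'p \<Rightarrow> real" and c :: real
  assumes maps: "\<And>p. p \<in> S \<Longrightarrow> \<sigma> p \<in> S"
    and invol: "\<And>p. p \<in> S \<Longrightarrow> \<sigma> (\<sigma> p) = p"
    and bal: "\<And>p. p \<in> S \<Longrightarrow> \<kappa> p * wt p = c * wt (\<sigma> p)"
  shows "(\<Sum>p\<in>S. wt p * (v p + \<kappa> p * v (\<sigma> p))) = (1 + c) * (\<Sum>p\<in>S. wt p * v p)"
proof -
  have "wt p * (\<kappa> p * v (\<sigma> p)) = c * (wt (\<sigma> p) * v (\<sigma> p))" if "p \<in> S" for p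
    using arg_cong[OF bal[OF that], of "\<lambda>x. x * v (\<sigma> p)"] by (simp only: ac_simps)
  then have "(\<Sum>p\<in>S. wt p * (\<kappa> p * v (\<sigma> p))) = c * (\<Sum>p\<in>S. wt (\<sigma> p) * v (\<sigma> p))"
    unfolding sum_distrib_left by (rule sum.cong[OF refl])
  also have "(\<Sum>p\<in>S. wt (\<sigma> p) * v (\<sigma> p)) = (\<Sum>p\<in>S. wt p * v p)"
    \<comment> \<open>As an involution of \<open>S\<close>, \<open>\<sigma>\<close> serves as its
      own inverse in the reindexing.\<close>
    by (rule sum.reindex_bij_witness[of _ \<sigma> \<sigma>]) (simp_all add: maps invol)
  finally show ?thesis
    by (simp add: distrib_left distrib_right sum.distrib)
qed

text \<open>Balance gives the ratio \<open>sqrt K / a\<close>, and \<open>K = a * b\<close> brings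
  it to the form in (i). Here \<open>a\<close>, \<open>b\<close> stand for \<open>\<kappa>\<close>
  and \<open>x\<close>, \<open>y\<close> for the weights, at \<open>p\<close> and
  \<open>\<sigma> p\<close> respectively.\<close>

lemma balanced_ratio:
  fixes a b x y K :: real
  assumes "0 < a" "0 < b" "0 < y" "a * b = K" "a * x = sqrt K * y"
  shows "x / y = sqrt (b / a)"
proof -
  have "x = sqrt K / a * y"
    using assms by (simp add: field_simps)
  then have "x / y = sqrt K / a"
    using assms by simp
  also have "\<dots> = sqrt (K / a\<^sup>2)"
    using assms by (simp add: real_sqrt_divide)
  also have "K / a\<^sup>2 = b / a"
    using assms by (auto simp: power2_eq_square)
  finally show ?thesis .
qed

text \<open>For weights proportional to \<open>1 / sqrt (\<kappa> p)\<close>, both sides of the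
  balance relation reduce to \<open>sqrt (\<kappa> p)\<close>, up to the common normalization
  \<open>Z\<close>.\<close>

lemma balanced_simplex_nonempty:
  fixes z :: "'n::finite \<Rightarrow> 'p"
  assumes inj: "inj z"
    and maps: "\<And>p. p \<in> range z \<Longrightarrow> \<sigma> p \<in> range z"
    and pos: "\<And>p. p \<in> range z \<Longrightarrow> \<kappa> p > 0"
    and K: "\<And>p. p \<in> range z \<Longrightarrow> \<kappa> p * \<kappa> (\<sigma> p) = K"
  shows "balanced_simplex z \<sigma> \<kappa> K \<noteq> {}"
proof -
  define Z where "Z = (\<Sum>p\<in>range z. 1 / sqrt (\<kappa> p))"
  define g where "g p = 1 / sqrt (\<kappa> p) / Z" for p
  have Z: "Z > 0"
    unfolding Z_def by (intro sum_pos) (auto simp: pos)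
  have g_pos: "g p > 0" if "p \<in> range z" for p
    using pos[OF that] Z by (simp add: g_def)
  have g_sum: "(\<Sum>p\<in>range z. g p) = 1"
    using Z by (simp only: g_def sum_divide_distrib[symmetric] Z_def[symmetric]) simp
  have g_bal: "\<kappa> p * g p = sqrt K * g (\<sigma> p)" if p: "p \<in> range z" for p
  proof -
    have "\<kappa> p / sqrt (\<kappa> p) = sqrt (\<kappa> p)"
      using pos[OF p] by (simp add: real_div_sqrt)
    \<comment> \<open>By (S4), \<open>sqrt K\<close> factors as
      \<open>sqrt (\<kappa> p) * sqrt (\<kappa> (\<sigma> p))\<close>.\<close>
    moreover have "sqrt K / sqrt (\<kappa> (\<sigma> p)) = sqrt (\<kappa> p)"
      using pos[OF maps[OF p]] by (simp add: real_sqrt_mult flip: K[OF p])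
    ultimately show ?thesis
      by (simp only: g_def times_divide_eq_right mult_1_right)
  qed
  have "(\<chi> i. g (z i)) \<in> balanced_simplex z \<sigma> \<kappa> K"
    using vec_lambda_in_prob_simplex[OF inj, of g] g_pos g_sum g_bal inj
    by (auto simp: balanced_simplex_def site_weight_vec_lambda maps nonneutral_sites_def
        less_imp_le)
  then show ?thesis
    by blast
qed

lemma balanced_simplex_open:
  assumes inj: "inj z" and \<pi>: "\<pi> \<in> balanced_simplex z \<sigma> \<kappa> K"
    and neutral: "\<And>p. p \<in> neutral_sites z \<sigma> \<Longrightarrow> site_weight z \<pi> p > 0"
  shows "\<pi> \<in> open_prob_simplex"
proof -
  have "0 < \<pi> $ i" for i
  proof -
    have "z i \<in> neutral_sites z \<sigma> \<or> z i \<in> nonneutral_sites z \<sigma>"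
      by (auto simp: neutral_sites_def nonneutral_sites_def)
    then have "0 < site_weight z \<pi> (z i)"
      using \<pi> neutral by (auto simp: balanced_simplex_def)
    then show ?thesis
      using inj by (simp add: site_weight_site)
  qed
  then show ?thesis
    using \<pi> by (simp add: open_prob_simplex_def balanced_simplex_def)
qed

text \<open>This is the freedom in (ii): the neutral weights are replaced by \<open>w\<close>, and
  the non-neutral weights of \<open>\<pi>\<close> are rescaled by a common factor to absorb the
  remaining mass. That mass must be positive, hence the strict bound on the sum of
  \<open>w\<close>.\<close>

lemma balanced_simplex_neutral_weights:
  fixes z :: "'n::finite \<Rightarrow> 'p"
  assumes inj: "inj z"
    and maps: "\<And>p. p \<in> range z \<Longrightarrow> \<sigma> p \<in> range z"
    and invol: "\<And>p. p \<in> range z \<Longrightarrow> \<sigma> (\<sigma> p) = p"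
    and nontriv: "nonneutral_sites z \<sigma> \<noteq> {}"
    and pos: "\<And>p. p \<in> range z \<Longrightarrow> \<kappa> p > 0"
    and K: "\<And>p. p \<in> range z \<Longrightarrow> \<kappa> p * \<kappa> (\<sigma> p) = K"
    and \<pi>: "\<pi> \<in> balanced_simplex z \<sigma> \<kappa> K"
    and w_nonneg: "\<And>p. p \<in> neutral_sites z \<sigma> \<Longrightarrow> w p \<ge> 0"
    and w_sum: "(\<Sum>p\<in>neutral_sites z \<sigma>. w p) < 1"
  shows "\<exists>\<pi>'\<in>balanced_simplex z \<sigma> \<kappa> K.
      (\<forall>p\<in>neutral_sites z \<sigma>. site_weight z \<pi>' p = w p) \<and>
      (\<exists>t>0. \<forall>p\<in>nonneutral_sites z \<sigma>. site_weight z \<pi>' p = t * site_weight z \<pi> p)"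
proof -
  define M where "M = (\<Sum>p\<in>nonneutral_sites z \<sigma>. site_weight z \<pi> p)"
  \<comment> \<open>The factor solves the normalization equation: neutral mass plus
    \<open>t * M\<close> equals 1.\<close>
  define t where "t = (1 - (\<Sum>p\<in>neutral_sites z \<sigma>. w p)) / M"
  define g where "g p = (if \<sigma> p = p then w p else t * site_weight z \<pi> p)" for p
  have \<pi>_pos: "site_weight z \<pi> p > 0" if "p \<in> nonneutral_sites z \<sigma>" for p
    using \<pi> that by (auto simp: balanced_simplex_def)
  have M: "M > 0"
    unfolding M_def by (intro sum_pos) (auto simp: \<pi>_pos nontriv, simp add: nonneutral_sites_def)
  have t: "t > 0"
    using M w_sum by (simp add: t_def)
  have g_neutral: "g p = w p" if "p \<in> neutral_sites z \<sigma>" for p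
    using that by (simp add: g_def neutral_sites_def)
  have g_nonneutral: "g p = t * site_weight z \<pi> p" if "p \<in> nonneutral_sites z \<sigma>" for p
    using that by (simp add: g_def nonneutral_sites_def)
  have g_pos: "g p > 0" if "p \<in> nonneutral_sites z \<sigma>" for p
    using that t by (simp add: g_nonneutral \<pi>_pos)
  have g_nonneg: "0 \<le> g p" if "p \<in> range z" for p
  proof (cases "p \<in> neutral_sites z \<sigma>")
    case True
    then show ?thesis by (simp add: g_neutral w_nonneg)
  next
    case False
    then have "p \<in> nonneutral_sites z \<sigma>"
      using that by (simp add: neutral_sites_def nonneutral_sites_def)
    then show ?thesis using g_pos by (simp add: less_imp_le)
  qed
  have "(\<Sum>p\<in>range z. g p) = (\<Sum>p\<in>neutral_sites z \<sigma>. w p) + t * M"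
    by (simp add: sum_range_split_neutral[where \<sigma> = \<sigma>] g_neutral g_nonneutral M_def
        sum_distrib_left)
  then have g_sum: "(\<Sum>p\<in>range z. g p) = 1"
    using M by (simp add: t_def)
  have g_bal: "\<kappa> p * g p = sqrt K * g (\<sigma> p)" if p: "p \<in> range z" for p
  proof (cases "\<sigma> p = p")
    case True
    \<comment> \<open>At a neutral site (S4) reads \<open>\<kappa> p * \<kappa> p = K\<close>, so
      balance holds whatever the weight is.\<close>
    then have "\<kappa> p = sqrt K"
      using K[OF p] pos[OF p] by auto
    then show ?thesis by (simp add: True)
  next
    case False
    \<comment> \<open>The partner site is non-neutral too, so \<open>g\<close> scales both weights
      by the same \<open>t\<close> and inherits balance from \<open>\<pi>\<close>.\<close>
    moreover have "\<sigma> (\<sigma> p) \<noteq> \<sigma> p"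
      using False invol[OF p] by simp
    moreover have "\<kappa> p * site_weight z \<pi> p = sqrt K * site_weight z \<pi> (\<sigma> p)"
      using \<pi> p by (auto simp: balanced_simplex_def)
    ultimately show ?thesis
      by (simp add: g_def mult.left_commute[of _ t])
  qed
  show ?thesis
  proof (intro bexI[of _ "\<chi> i. g (z i)"] exI[of _ t] conjI ballI)
    show "(\<chi> i. g (z i)) \<in> balanced_simplex z \<sigma> \<kappa> K"
      using vec_lambda_in_prob_simplex[OF inj g_nonneg g_sum] g_pos g_bal inj
      by (auto simp: balanced_simplex_def site_weight_vec_lambda maps nonneutral_sites_def)
    show "site_weight z (\<chi> i. g (z i)) p = w p" if "p \<in> neutral_sites z \<sigma>" for p
      using that g_neutral[OF that] inj by (simp add: site_weight_vec_lambda neutral_sites_def)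
    show "site_weight z (\<chi> i. g (z i)) p = t * site_weight z \<pi> p"
      if "p \<in> nonneutral_sites z \<sigma>" for p
      using that g_nonneutral[OF that] inj
      by (simp add: site_weight_vec_lambda nonneutral_sites_def)
  qed (rule t)
qed

text \<open>Claim (iii) is contained in the single value \<open>1 / (1 + sqrt K)\<close> shared by
  all members of \<open>F\<close>. The last conjunct renders (ii): neutral weights can be prescribed
  at will, with total below 1 because the ratios in (i) force nonzero weights at non-neutral
  sites.\<close>

theorem theorem3p3:
  fixes z :: "'n::finite \<Rightarrow> 'p"
    and C :: "real ^ 'n \<Rightarrow> real \<Rightarrow> real"
    and u s :: "'p \<Rightarrow> real \<Rightarrow> real"
    and f :: "'k::finite \<Rightarrow> real \<Rightarrow> real"
    and A B :: "'k \<Rightarrow> 'p \<Rightarrow> real"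
    and \<sigma> :: "'p \<Rightarrow> 'p"
    and \<kappa> :: "'p \<Rightarrow> real"
    and K :: real
  assumes m_ge_2: "CARD('n) \<ge> 2"
    and sites_distinct: "inj z"
    and S1_C1: "\<And>\<gamma>. \<gamma> \<in> {0<..<1} \<Longrightarrow> C1_on (\<lambda>\<pi>. C \<pi> \<gamma>) open_prob_simplex"
    and S1_cont: "\<And>\<gamma>. \<gamma> \<in> {0<..<1} \<Longrightarrow> continuous_on prob_simplex (\<lambda>\<pi>. C \<pi> \<gamma>)"
    and S2_ratio: "\<And>\<pi> \<gamma>. \<pi> \<in> prob_simplex \<Longrightarrow> \<gamma> \<in> {0<..<1} \<Longrightarrow>
           C \<pi> \<gamma> = (\<Sum>i\<in>UNIV. \<pi> $ i * u (z i) \<gamma>) / (\<Sum>i\<in>UNIV. \<pi> $ i * s (z i) \<gamma>)"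
    and S2_pos: "\<And>\<pi> \<gamma>. \<pi> \<in> prob_simplex \<Longrightarrow> \<gamma> \<in> {0<..<1} \<Longrightarrow>
           (\<Sum>i\<in>UNIV. \<pi> $ i * s (z i) \<gamma>) > 0"
    and S2_u: "\<And>p \<gamma>. p \<in> range z \<Longrightarrow> \<gamma> \<in> {0<..<1} \<Longrightarrow>
           u p \<gamma> = (\<Sum>\<nu>\<in>UNIV. f \<nu> \<gamma> * A \<nu> p)"
    and S2_s: "\<And>p \<gamma>. p \<in> range z \<Longrightarrow> \<gamma> \<in> {0<..<1} \<Longrightarrow>
           s p \<gamma> = (\<Sum>\<nu>\<in>UNIV. f \<nu> \<gamma> * (A \<nu> p + B \<nu> p))"
    and S2_indep_f: "lin_indep_functions_on {0<..<1} f"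
    and S2_indep_A: "lin_indep_family (\<lambda>i. (\<chi> \<nu>. A \<nu> (z i)) :: real ^ 'k)"
    and S3_maps: "\<And>p. p \<in> range z \<Longrightarrow> \<sigma> p \<in> range z"
    and S3_invol: "\<And>p. p \<in> range z \<Longrightarrow> \<sigma> (\<sigma> p) = p"
    and S3_nontriv: "\<exists>p\<in>range z. \<sigma> p \<noteq> p"
    and S3_pos: "\<And>p. p \<in> range z \<Longrightarrow> \<kappa> p > 0"
    and S3_B: "\<And>\<nu> p. p \<in> range z \<Longrightarrow> B \<nu> p = \<kappa> p * A \<nu> (\<sigma> p)"
    and S4_pos: "K > 0"
    and S4: "\<And>p. p \<in> range z \<Longrightarrow> \<kappa> p * \<kappa> (\<sigma> p) = K"
  shows "\<exists>F. F \<noteq> {} \<and> F \<subseteq> prob_simplex \<and>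
     (\<forall>\<pi>\<in>F. (\<forall>p\<in>neutral_sites z \<sigma>. site_weight z \<pi> p > 0) \<longrightarrow> \<pi> \<in> open_prob_simplex) \<and>
     (\<forall>\<pi>\<in>F. \<forall>\<gamma>\<in>{0<..<1}. C \<pi> \<gamma> = 1 / (1 + sqrt K)) \<and>
     (\<forall>\<pi>\<in>F. \<forall>p\<in>nonneutral_sites z \<sigma>.
        site_weight z \<pi> p / site_weight z \<pi> (\<sigma> p) = sqrt (\<kappa> (\<sigma> p) / \<kappa> p)) \<and>
     (\<forall>\<pi>\<in>F. \<forall>w. (\<forall>p\<in>neutral_sites z \<sigma>. w p \<ge> 0) \<and> (\<Sum>p\<in>neutral_sites z \<sigma>. w p) < 1 \<longrightarrow>
        (\<exists>\<pi>'\<in>F. (\<forall>p\<in>neutral_sites z \<sigma>. site_weight z \<pi>' p = w p) \<and>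
           (\<exists>t>0. \<forall>p\<in>nonneutral_sites z \<sigma>. site_weight z \<pi>' p = t * site_weight z \<pi> p)))"
proof (intro exI[of _ "balanced_simplex z \<sigma> \<kappa> K"] conjI ballI impI allI)
  show "balanced_simplex z \<sigma> \<kappa> K \<noteq> {}"
    using sites_distinct S3_maps S3_pos S4 by (rule balanced_simplex_nonempty)
  show "balanced_simplex z \<sigma> \<kappa> K \<subseteq> prob_simplex"
    by (auto simp: balanced_simplex_def)
next
  fix \<pi>
  assume "\<pi> \<in> balanced_simplex z \<sigma> \<kappa> K" "\<forall>p\<in>neutral_sites z \<sigma>. site_weight z \<pi> p > 0"
  then show "\<pi> \<in> open_prob_simplex"
    by (intro balanced_simplex_open[OF sites_distinct]) auto
next
  fix \<pi> and \<gamma> :: real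
  assume \<pi>: "\<pi> \<in> balanced_simplex z \<sigma> \<kappa> K" and \<gamma>: "\<gamma> \<in> {0<..<1}"
  let ?U = "\<Sum>p\<in>range z. site_weight z \<pi> p * u p \<gamma>"
  have simplex: "\<pi> \<in> prob_simplex"
    and bal: "\<And>p. p \<in> range z \<Longrightarrow> \<kappa> p * site_weight z \<pi> p = sqrt K * site_weight z \<pi> (\<sigma> p)"
    using \<pi> by (auto simp: balanced_simplex_def)
  \<comment> \<open>Since \<open>\<kappa>\<close> does not depend on \<open>\<nu>\<close>, it can be
    pulled out of the expansion of the \<open>B\<close> part, leaving \<open>u\<close> at the
    partner site.\<close>
  have s: "s p \<gamma> = u p \<gamma> + \<kappa> p * u (\<sigma> p) \<gamma>" if "p \<in> range z" for p
    using S2_s[OF that \<gamma>] S2_u[OF that \<gamma>] S2_u[OF S3_maps[OF that] \<gamma>] S3_B[OF that]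
    by (simp add: distrib_left sum.distrib sum_distrib_left mult.left_commute)
  have "(\<Sum>i\<in>UNIV. \<pi> $ i * s (z i) \<gamma>) = (\<Sum>p\<in>range z. site_weight z \<pi> p * s p \<gamma>)"
    by (rule sum_sites_eq[OF sites_distinct])
  also have "\<dots> = (\<Sum>p\<in>range z. site_weight z \<pi> p * (u p \<gamma> + \<kappa> p * u (\<sigma> p) \<gamma>))"
    by (intro sum.cong) (simp_all add: s)
  also have "\<dots> = (1 + sqrt K) * ?U"
    using S3_maps S3_invol bal by (rule balanced_weighted_sum)
  finally have denominator: "(\<Sum>i\<in>UNIV. \<pi> $ i * s (z i) \<gamma>) = (1 + sqrt K) * ?U" .
  \<comment> \<open>Positivity of the denominator in (S2) is what permits cancelling the
    numerator.\<close>
  then have "?U \<noteq> 0"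
    using S2_pos[OF simplex \<gamma>] by auto
  then show "C \<pi> \<gamma> = 1 / (1 + sqrt K)"
    by (simp add: S2_ratio[OF simplex \<gamma>] denominator
        sum_sites_eq[OF sites_distinct, of \<pi> "\<lambda>p. u p \<gamma>"])
next
  fix \<pi> p
  assume \<pi>: "\<pi> \<in> balanced_simplex z \<sigma> \<kappa> K" and p: "p \<in> nonneutral_sites z \<sigma>"
  \<comment> \<open>The partner site is non-neutral as well, so the divisor in the ratio is
    positive.\<close>
  have range: "p \<in> range z" and "\<sigma> p \<in> nonneutral_sites z \<sigma>"
    using p S3_maps[of p] S3_invol[of p] by (auto simp: nonneutral_sites_def)
  then have "0 < site_weight z \<pi> (\<sigma> p)"
    "\<kappa> p * site_weight z \<pi> p = sqrt K * site_weight z \<pi> (\<sigma> p)"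
    using \<pi> by (auto simp: balanced_simplex_def)
  then show "site_weight z \<pi> p / site_weight z \<pi> (\<sigma> p) = sqrt (\<kappa> (\<sigma> p) / \<kappa> p)"
    by (intro balanced_ratio[OF S3_pos[OF range] S3_pos[OF S3_maps[OF range]] _ S4[OF range]])
next
  fix \<pi> and w :: "'p \<Rightarrow> real"
  assume \<pi>: "\<pi> \<in> balanced_simplex z \<sigma> \<kappa> K"
    and w: "(\<forall>p\<in>neutral_sites z \<sigma>. w p \<ge> 0) \<and> (\<Sum>p\<in>neutral_sites z \<sigma>. w p) < 1"
  have w_nonneg: "w p \<ge> 0" if "p \<in> neutral_sites z \<sigma>" for p
    using w that by blast
  have w_sum: "(\<Sum>p\<in>neutral_sites z \<sigma>. w p) < 1"
    using w by blast
  have nontriv: "nonneutral_sites z \<sigma> \<noteq> {}"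
    using S3_nontriv by (auto simp: nonneutral_sites_def)
  show "\<exists>\<pi>'\<in>balanced_simplex z \<sigma> \<kappa> K.
      (\<forall>p\<in>neutral_sites z \<sigma>. site_weight z \<pi>' p = w p) \<and>
      (\<exists>t>0. \<forall>p\<in>nonneutral_sites z \<sigma>. site_weight z \<pi>' p = t * site_weight z \<pi> p)"
    using sites_distinct S3_maps S3_invol nontriv S3_pos S4 \<pi> w_nonneg w_sum
    by (rule balanced_simplex_neutral_weights)
qed

end
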